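(* Let $n\geq 4$ and let $\mathfrak g$ be a nilpotent Lie algebra of real dimension $2n$ endowed with a strongly non-nilpotent complex structure $J$. Then the center $\mathfrak g_1=Z(\mathfrak g)$ satisfies $1\leq \dim \mathfrak g_1\leq n-3$.
   Context: Lie algebras are real and finite-dimensional. A complex structure on $\mathfrak g$ is a linear endomorphism $J:\mathfrak g\to\mathfrak g$ with $J^2=-\mathrm{Id}$ and $[X,Y]+J[JX,Y]+J[X,JY]-[JX,JY]=0$ for all $X,Y\in\mathfrak g$. Let $\mathfrak a_1(J)=\{X\in\mathfrak g \mid [X,\mathfrak g]=0 \text{ and } [JX,\mathfrak g]=0\}$, the largest $J$-invariant subspace of the center. $J$ is called strongly non-nilpotent (SnN) if $\mathfrak a_1(J)=\{0\}$. *)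

theory Defs
  imports "HOL-Analysis.Analysis"
begin

locale real_lie_algebra =
  fixes bracket :: "'a::real_vector \<Rightarrow> 'a \<Rightarrow> 'a"
  assumes finite_dim: "\<exists>B. finite B \<and> span B = (UNIV :: 'a set)"
    and bilinear_bracket: "bilinear bracket"
    and alternating: "bracket x x = 0"
    and jacobi:
      "bracket x (bracket y z) + bracket y (bracket z x) + bracket z (bracket x y) = 0"

definition lie_center :: "('a::real_vector \<Rightarrow> 'a \<Rightarrow> 'a) \<Rightarrow> 'a set" where
  "lie_center bracket = {x. \<forall>y. bracket x y = 0}"

primrec lower_central_series :: "('a::real_vector \<Rightarrow> 'a \<Rightarrow> 'a) \<Rightarrow> nat \<Rightarrow> 'a set" where
  "lower_central_series bracket 0 = UNIV"
| "lower_central_series bracket (Suc k) =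
     span {bracket x y | x y. y \<in> lower_central_series bracket k}"

text \<open>
  Nilpotency is vanishing of the lower central series; the equivalent form in terms of
  the ascending central series (whose first term is the center) is lemma
  \<open>lie_nilpotent_iff_ascending\<close> below.
\<close>

definition lie_nilpotent :: "('a::real_vector \<Rightarrow> 'a \<Rightarrow> 'a) \<Rightarrow> bool" where
  "lie_nilpotent bracket \<longleftrightarrow> (\<exists>k. lower_central_series bracket k = {0})"

primrec ascending_central_series :: "('a::real_vector \<Rightarrow> 'a \<Rightarrow> 'a) \<Rightarrow> nat \<Rightarrow> 'a set" where
  "ascending_central_series bracket 0 = {0}"
| "ascending_central_series bracket (Suc k) =
     {x. \<forall>y. bracket x y \<in> ascending_central_series bracket k}"

definition complex_structure ::
    "('a::real_vector \<Rightarrow> 'a \<Rightarrow> 'a) \<Rightarrow> ('a \<Rightarrow> 'a) \<Rightarrow> bool" where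
  "complex_structure bracket J \<longleftrightarrow>
     linear J \<and> (\<forall>x. J (J x) = - x) \<and>
     (\<forall>x y. bracket x y + J (bracket (J x) y) + J (bracket x (J y)) - bracket (J x) (J y) = 0)"

text \<open>The largest \<open>J\<close>-invariant subspace \<open>a\<^sub>1(J)\<close> of the center.\<close>

definition invariant_center ::
    "('a::real_vector \<Rightarrow> 'a \<Rightarrow> 'a) \<Rightarrow> ('a \<Rightarrow> 'a) \<Rightarrow> 'a set" where
  "invariant_center bracket J = {x. (\<forall>y. bracket x y = 0) \<and> (\<forall>y. bracket (J x) y = 0)}"

definition strongly_non_nilpotent ::
    "('a::real_vector \<Rightarrow> 'a \<Rightarrow> 'a) \<Rightarrow> ('a \<Rightarrow> 'a) \<Rightarrow> bool" where
  "strongly_non_nilpotent bracket J \<longleftrightarrow> invariant_center bracket J = {0}"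

lemma ascending_central_series_1:
  "ascending_central_series bracket 1 = lie_center bracket"
  by (simp add: lie_center_def)

context real_lie_algebra
begin

lemma bracket_antisym: "bracket x y = - bracket y x"
proof -
  have "bracket (x + y) (x + y) = 0" by (rule alternating)
  then have "bracket x y + bracket y x = 0"
    using alternating[of x] alternating[of y]
    by (simp add: bilinear_ladd[OF bilinear_bracket] bilinear_radd[OF bilinear_bracket] add.commute)
  then show ?thesis by (simp add: eq_neg_iff_add_eq_0 add.commute)
qed

lemma subspace_ascending: "subspace (ascending_central_series bracket k)"
proof (induction k)
  case 0
  show ?case by (simp add: subspace_def)
next
  case (Suc k)
  then show ?case
    by (simp add: subspace_def bilinear_ladd[OF bilinear_bracket]
        bilinear_lmul[OF bilinear_bracket] bilinear_lzero[OF bilinear_bracket])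
qed

lemma lower_le_ascending:
  assumes "ascending_central_series bracket s = UNIV" and "k \<le> s"
  shows "lower_central_series bracket k \<subseteq> ascending_central_series bracket (s - k)"
  using assms(2)
proof (induction k)
  case 0
  show ?case by (simp add: assms(1))
next
  case (Suc k)
  have eq: "s - k = Suc (s - Suc k)" using Suc.prems by simp
  have "bracket x y \<in> ascending_central_series bracket (s - Suc k)"
    if "y \<in> lower_central_series bracket k" for x y
  proof -
    have "y \<in> ascending_central_series bracket (Suc (s - Suc k))"
      using that Suc eq by auto
    then have "bracket y x \<in> ascending_central_series bracket (s - Suc k)" by simp
    then show ?thesis
      using bracket_antisym[of x y] subspace_neg[OF subspace_ascending] by metis
  qed
  then have "{bracket x y | x y. y \<in> lower_central_series bracket k}
      \<subseteq> ascending_central_series bracket (s - Suc k)"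
    by blast
  then show ?case
    unfolding lower_central_series.simps by (rule span_minimal[OF _ subspace_ascending])
qed

lemma lower_le_ascending':
  assumes "lower_central_series bracket s = {0}" and "k \<le> s"
  shows "lower_central_series bracket (s - k) \<subseteq> ascending_central_series bracket k"
  using assms(2)
proof (induction k)
  case 0
  show ?case by (simp add: assms(1))
next
  case (Suc k)
  have eq: "s - k = Suc (s - Suc k)" using Suc.prems by simp
  show ?case
  proof
    fix y assume y: "y \<in> lower_central_series bracket (s - Suc k)"
    have "bracket y x \<in> ascending_central_series bracket k" for x
    proof -
      have "bracket x y \<in> lower_central_series bracket (s - k)"
        unfolding eq using y by (auto intro: span_base)
      then have "bracket x y \<in> ascending_central_series bracket k"
        using Suc by auto
      then show ?thesis
        using bracket_antisym[of y x] subspace_neg[OF subspace_ascending] by metis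
    qed
    then show "y \<in> ascending_central_series bracket (Suc k)" by simp
  qed
qed

lemma lie_nilpotent_iff_ascending:
  "lie_nilpotent bracket \<longleftrightarrow> (\<exists>s. ascending_central_series bracket s = UNIV)"
proof
  assume "lie_nilpotent bracket"
  then obtain s where "lower_central_series bracket s = {0}"
    by (auto simp: lie_nilpotent_def)
  from lower_le_ascending'[OF this, of s]
  have "ascending_central_series bracket s = UNIV" by auto
  then show "\<exists>s. ascending_central_series bracket s = UNIV" by blast
next
  assume "\<exists>s. ascending_central_series bracket s = UNIV"
  then obtain s where "ascending_central_series bracket s = UNIV" by blast
  from lower_le_ascending[OF this, of s]
  have "lower_central_series bracket s \<subseteq> {0}" by simp
  moreover have "0 \<in> lower_central_series bracket s"
    by (cases s) (simp_all add: span_zero)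
  ultimately show "lie_nilpotent bracket" by (auto simp: lie_nilpotent_def)
qed

end

end

theory Submission
  imports Defs
begin

text \<open>
  Let \<open>Z\<^sub>1\<close> be the center and \<open>Z\<^sub>2\<close> the second center. The proof rests on two facts. First, if \<open>x\<close>
  is central, the Nijenhuis identity says that \<open>ad (J x)\<close> commutes with \<open>J\<close>; so its image is
  a complex subspace, and if \<open>x \<noteq> 0\<close> this image fits into no subspace that meets its own
  \<open>J\<close>-image trivially (lemma \<open>J_center_image_zero\<close>). Secondly, Engel's argument: an ideal \<open>I\<close>
  not contained in a set \<open>S\<close> with \<open>0 \<in> S\<close> has an element outside \<open>S\<close> all of whose brackets
  lie in \<open>S\<close> (lemma \<open>ideal_element_bracketed_into\<close>).

  With \<open>I\<close> the whole algebra and \<open>S = {0}\<close>, Engel's argument gives a nonzero central element.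
  For the upper bound suppose that \<open>dim Z\<^sub>1 \<ge> n - 2\<close>, which is at least 2. The sum
  \<open>Z\<^sub>1 + J Z\<^sub>1\<close> is direct and meets \<open>Z\<^sub>2\<close> only in \<open>Z\<^sub>1\<close>. So for any \<open>v\<close> in \<open>Z\<^sub>2\<close> outside \<open>Z\<^sub>1\<close>, the
  complex span \<open>M\<close> of \<open>Z\<^sub>1\<close> and \<open>v\<close> has complex codimension at most one. Engel's argument
  with \<open>S = M\<close> yields \<open>u\<close> with \<open>[u, g] \<subseteq> M\<close> that together with \<open>M\<close> generates everything as
  a complex space, and \<open>M\<close> turns out to be an ideal. Three more applications of Engel's
  argument, all with \<open>I = M\<close> and with growing \<open>S\<close>, exhaust the room that is left:

  \<^item> \<open>S = Z\<^sub>1 + \<real>v\<close> shows that \<open>v\<close> can be chosen with \<open>J v \<in> Z\<^sub>2\<close> as well;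
  \<^item> \<open>S = Z\<^sub>1 + \<real>v + \<real>Jv\<close> gives a central \<open>x\<^sub>1 \<noteq> 0\<close> for which \<open>[J x\<^sub>1, u]\<close> is a nonzero complex
    multiple of \<open>v\<close>, so that we may rename it \<open>v\<close>; since \<open>J x\<^sub>1\<close> centralizes \<open>M\<close>, which contains
    \<open>[u, J u]\<close>, the Jacobi identity then forces \<open>[v, J u] = [J v, u] = 0\<close>, while
    \<open>q = [v, u] = [J v, J u] \<noteq> 0\<close> because \<open>v\<close> is not central;
  \<^item> \<open>S = Z\<^sub>1 + \<real>v + \<real>Jv + \<real>Jx\<^sub>1\<close>, which does not contain \<open>M\<close> as \<open>dim Z\<^sub>1 \<ge> 2\<close>, gives a central
    \<open>x\<close> outside \<open>\<real>x\<^sub>1\<close>, and the Jacobi identity for \<open>J x, u, J u\<close> implies \<open>[J x, u] = \<alpha> v\<close> with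
    \<open>\<alpha>\<close> real. Then \<open>J (x - \<alpha> x\<^sub>1)\<close> is central, which contradicts strong non-nilpotency.
\<close>

section \<open>Complex spans\<close>

locale complex_operator =
  fixes J :: "'a::real_vector \<Rightarrow> 'a"
  assumes linear_J: "linear J"
    and J_J [simp]: "J (J x) = - x"
begin

lemma J_simps [simp]:
  "J (x + y) = J x + J y" "J (x - y) = J x - J y" "J (- x) = - J x" "J (c *\<^sub>R x) = c *\<^sub>R J x" "J 0 = 0"
  by (simp_all add: linear_add[OF linear_J] linear_diff[OF linear_J] linear_neg[OF linear_J]
      linear_cmul[OF linear_J] linear_0[OF linear_J])

definition complex_subspace :: "'a set \<Rightarrow> bool" where
  "complex_subspace N \<longleftrightarrow> subspace N \<and> (\<forall>x\<in>N. J x \<in> N)"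

definition complex_span :: "'a set \<Rightarrow> 'a set" where
  "complex_span S = span (S \<union> J ` S)"

lemma complex_subspaceD:
  assumes "complex_subspace N"
  shows "subspace N" "x \<in> N \<Longrightarrow> J x \<in> N"
  using assms by (auto simp: complex_subspace_def)

lemma subset_complex_span: "S \<subseteq> complex_span S"
  by (auto simp: complex_span_def intro: span_base)

lemma complex_subspace_span: "complex_subspace (complex_span S)"
proof -
  let ?T = "S \<union> J ` S"
  have "J ` ?T \<subseteq> span ?T"
  proof clarify
    fix y assume "y \<in> ?T"
    then show "J y \<in> span ?T"
      by (auto intro!: span_neg[of _ ?T] intro: span_base)
  qed
  then have "span (J ` ?T) \<subseteq> span ?T" by (simp add: span_minimal)
  then have "J ` span ?T \<subseteq> span ?T" by (simp add: linear_span_image[OF linear_J])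
  then show ?thesis by (auto simp: complex_subspace_def complex_span_def)
qed

lemma complex_span_minimal: "S \<subseteq> N \<Longrightarrow> complex_subspace N \<Longrightarrow> complex_span S \<subseteq> N"
  unfolding complex_span_def complex_subspace_def by (intro span_minimal) auto

lemma span_insertE:
  assumes "y \<in> span (insert v S)"
  obtains w a where "w \<in> span S" "y = w + a *\<^sub>R v"
proof -
  from assms obtain a where "y - a *\<^sub>R v \<in> span S" unfolding span_insert by blast
  then show thesis by (intro that[of "y - a *\<^sub>R v" a]) auto
qed

lemma complex_span_insertE:
  assumes "y \<in> complex_span (insert v S)"
  obtains w a b where "w \<in> complex_span S" "y = w + a *\<^sub>R v + b *\<^sub>R J v"
proof -
  have eq: "insert v S \<union> J ` insert v S = insert v (insert (J v) (S \<union> J ` S))" by auto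
  from assms obtain a b where "y - a *\<^sub>R v - b *\<^sub>R J v \<in> complex_span S"
    unfolding complex_span_def eq span_insert[of v] span_insert[of "J v"] by blast
  then show thesis
    by (intro that[of "y - a *\<^sub>R v - b *\<^sub>R J v" a b]) auto
qed

lemma complex_span_subspaceE:
  assumes "subspace S" "y \<in> complex_span S"
  obtains z x where "z \<in> S" "x \<in> S" "y = z + J x"
proof -
  have "complex_subspace {z + J x | z x. z \<in> S \<and> x \<in> S}" (is "complex_subspace ?T")
    unfolding complex_subspace_def
  proof
    have "subspace (J ` S)" using assms(1) linear_J by (simp add: linear_subspace_image)
    from subspace_sums[OF assms(1) this] show "subspace ?T"
      by (rule back_subst[where P = subspace]) blast
    show "\<forall>x\<in>?T. J x \<in> ?T"
    proof clarify
      fix z x assume "z \<in> S" "x \<in> S"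
      then show "\<exists>z' x'. J (z + J x) = z' + J x' \<and> z' \<in> S \<and> x' \<in> S"
        using assms(1) by (intro exI[of _ "- x"] exI[of _ z]) (simp add: subspace_neg)
    qed
  qed
  moreover have "S \<subseteq> ?T"
    using subspace_0[OF assms(1)] by force
  ultimately have "complex_span S \<subseteq> ?T" by (rule complex_span_minimal[rotated])
  with assms(2) that show thesis by blast
qed

text \<open>A complex multiple of \<open>v\<close> lies in a complex subspace without \<open>v\<close> only if the scalar
  \<open>a + b i\<close> is zero, since otherwise one can divide by it.\<close>

lemma complex_multiple_notin:
  assumes N: "complex_subspace N" and "v \<notin> N" and y: "a *\<^sub>R v + b *\<^sub>R J v \<in> N"
  shows "a = 0 \<and> b = 0"
proof (rule ccontr)
  assume "\<not> (a = 0 \<and> b = 0)"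
  then have ne: "a * a + b * b \<noteq> 0" by (simp add: sum_squares_eq_zero_iff)
  have "a *\<^sub>R (a *\<^sub>R v + b *\<^sub>R J v) - b *\<^sub>R J (a *\<^sub>R v + b *\<^sub>R J v) \<in> N"
    using complex_subspaceD[OF N] y by (blast intro: subspace_diff subspace_scale)
  also have "a *\<^sub>R (a *\<^sub>R v + b *\<^sub>R J v) - b *\<^sub>R J (a *\<^sub>R v + b *\<^sub>R J v) = (a * a + b * b) *\<^sub>R v"
    by (simp add: algebra_simps)
  finally have "(1 / (a * a + b * b)) *\<^sub>R (a * a + b * b) *\<^sub>R v \<in> N"
    by (rule subspace_scale[OF complex_subspaceD(1)[OF N]])
  moreover have "(1 / c) *\<^sub>R c *\<^sub>R v = v" if "c \<noteq> 0" for c :: real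
    using that by simp
  ultimately show False using ne \<open>v \<notin> N\<close> by metis
qed

end

section \<open>Engel's argument\<close>

context real_lie_algebra
begin

lemmas bracket_simps =
  bilinear_ladd[OF bilinear_bracket] bilinear_radd[OF bilinear_bracket]
  bilinear_lsub[OF bilinear_bracket] bilinear_rsub[OF bilinear_bracket]
  bilinear_lneg[OF bilinear_bracket] bilinear_rneg[OF bilinear_bracket]
  bilinear_lmul[OF bilinear_bracket] bilinear_rmul[OF bilinear_bracket]
  bilinear_lzero[OF bilinear_bracket] bilinear_rzero[OF bilinear_bracket]
  alternating

lemma subspace_center: "subspace (lie_center bracket)"
  using subspace_ascending[of 1] by (simp add: lie_center_def)

lemma centerI: "(\<And>y. bracket z y = 0) \<Longrightarrow> z \<in> lie_center bracket"
  by (simp add: lie_center_def)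

lemma bracket_center [simp]:
  assumes "z \<in> lie_center bracket"
  shows "bracket z y = 0" "bracket y z = 0"
  using assms bracket_antisym[of y z] by (simp_all add: lie_center_def)

lemma bracket_bracket:
  "bracket x (bracket y z) = bracket (bracket x y) z + bracket y (bracket x z)"
proof -
  have "bracket y (bracket z x) = - bracket y (bracket x z)"
    by (subst bracket_antisym[of z x]) (simp add: bracket_simps)
  moreover have "bracket z (bracket x y) = - bracket (bracket x y) z"
    by (rule bracket_antisym)
  ultimately show ?thesis using jacobi[of x y z] by (simp add: algebra_simps)
qed

text \<open>The ascending central series reaches the ideal \<open>I\<close> before it exhausts the algebra: an
  element of \<open>I - S\<close> of the lowest possible level of the series is bracketed into a lower level,
  hence into \<open>S\<close>. For \<open>S = {0}\<close> this produces central elements in \<open>I\<close>; the freedom in \<open>S\<close>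
  is what replaces repeated passage to quotients below.\<close>

lemma ideal_element_bracketed_into:
  assumes nil: "lie_nilpotent bracket"
    and ideal: "\<And>x u. x \<in> I \<Longrightarrow> bracket x u \<in> I"
    and "0 \<in> S" and nsub: "\<not> I \<subseteq> S"
  obtains y where "y \<in> I" "y \<notin> S" "\<And>u. bracket y u \<in> S"
proof -
  let ?P = "\<lambda>j. \<not> I \<inter> ascending_central_series bracket j \<subseteq> S"
  obtain s where "ascending_central_series bracket s = UNIV"
    using nil lie_nilpotent_iff_ascending by blast
  then have P: "?P s" using nsub by simp
  define j where "j = (LEAST j. ?P j)"
  have j: "?P j" unfolding j_def using P by (rule LeastI)
  have "j \<noteq> 0"
  proof
    assume "j = 0"
    with j \<open>0 \<in> S\<close> show False by auto
  qed
  then obtain i where i: "j = Suc i" by (cases j) auto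
  then have "\<not> ?P i" unfolding j_def by (intro not_less_Least) simp
  then have sub: "I \<inter> ascending_central_series bracket i \<subseteq> S" by blast
  from j obtain y where y: "y \<in> I" "y \<in> ascending_central_series bracket (Suc i)" "y \<notin> S"
    unfolding i by blast
  have "bracket y u \<in> S" for u
    using y sub ideal[of y u] by auto
  with y that show thesis by blast
qed

section \<open>Dimension in finite-dimensional real vector spaces\<close>

text \<open>The carrier type belongs only to the class of real vector spaces, so the dimension theory of
  finite-dimensional spaces has to be specialised to a basis obtained from the locale assumption.\<close>

lemma finite_dimensional:
  obtains B :: "'a set" where "finite_dimensional_vector_space (*\<^sub>R) B"
proof -
  obtain B :: "'a set" where B: "finite B" "span B = UNIV" using finite_dim by blast
  obtain C where C: "C \<subseteq> (UNIV :: 'a set)" "independent C" "(UNIV :: 'a set) \<subseteq> span C"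
    by (rule basis_exists[of "UNIV :: 'a set"])
  have "finite C"
    using independent_span_bound[OF B(1) C(2)] B(2) by simp
  moreover have "span C = UNIV" using C(3) by (rule top_le)
  ultimately have "finite_dimensional_vector_space (*\<^sub>R) C"
    using C(2) by unfold_locales (simp_all only: dependent_raw_def[symmetric] span_raw_def[symmetric] not_False_eq_True)
  then show thesis by (rule that)
qed

lemma dim_insert_notin:
  fixes S :: "'a set"
  assumes "x \<notin> span S"
  shows "dim (insert x S) = dim S + 1"
proof -
  obtain B :: "'a set" where "finite_dimensional_vector_space (*\<^sub>R) B" by (rule finite_dimensional)
  from finite_dimensional_vector_space.dim_insert[OF this, of x S, folded dim_raw_def span_raw_def]
  show ?thesis using assms by simp
qed

lemma dim_full_imp_UNIV:
  fixes S :: "'a set"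
  assumes "subspace S" "dim (UNIV :: 'a set) \<le> dim S"
  shows "S = UNIV"
proof -
  obtain B :: "'a set" where "finite_dimensional_vector_space (*\<^sub>R) B" by (rule finite_dimensional)
  from finite_dimensional_vector_space.subspace_dim_equal[OF this, of S UNIV, folded dim_raw_def subspace_raw_def]
  show ?thesis using assms by simp
qed

lemma dim_direct_sum:
  fixes S T :: "'a set"
  assumes "subspace S" "subspace T" "S \<inter> T \<subseteq> {0}"
  shows "dim {x + y | x y. x \<in> S \<and> y \<in> T} = dim S + dim T"
proof -
  obtain B :: "'a set" where fd: "finite_dimensional_vector_space (*\<^sub>R) B" by (rule finite_dimensional)
  have "dim (S \<inter> T) = 0"
    using finite_dimensional_vector_space.dim_eq_0[OF fd, folded dim_raw_def] assms(3) by blast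
  with finite_dimensional_vector_space.dim_sums_Int[OF fd, of S T, folded dim_raw_def subspace_raw_def]
  show ?thesis using assms by simp
qed

lemma dim_injective_image:
  fixes S :: "'a set" and f :: "'a \<Rightarrow> 'a"
  assumes "linear f" "inj f"
  shows "dim (f ` S) = dim S"
proof -
  obtain B :: "'a set" where fd: "finite_dimensional_vector_space (*\<^sub>R) B" by (rule finite_dimensional)
  then have "finite_dimensional_vector_space_pair_1 (*\<^sub>R) B ((*\<^sub>R) :: real \<Rightarrow> 'a \<Rightarrow> 'a)"
    by (simp add: finite_dimensional_vector_space_pair_1_def real_vector.vector_space_axioms)
  from finite_dimensional_vector_space_pair_1.dim_image_eq[OF this, of f S, folded dim_raw_def span_raw_def]
  show ?thesis using assms unfolding linear_def by (metis inj_on_subset subset_UNIV)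
qed

lemma dim_pos:
  fixes S :: "'a set"
  assumes "x \<in> S" "x \<noteq> 0"
  shows "1 \<le> dim S"
proof -
  obtain B :: "'a set" where fd: "finite_dimensional_vector_space (*\<^sub>R) B" by (rule finite_dimensional)
  have "dim S \<noteq> 0"
    using finite_dimensional_vector_space.dim_eq_0[OF fd, folded dim_raw_def] assms by blast
  then show ?thesis by simp
qed

end

section \<open>Strongly non-nilpotent complex structures\<close>

locale snn_lie_algebra = real_lie_algebra bracket + complex_operator J
  for bracket :: "'a::real_vector \<Rightarrow> 'a \<Rightarrow> 'a" and J :: "'a \<Rightarrow> 'a" +
  assumes nilpotent: "lie_nilpotent bracket"
    and nijenhuis:
      "bracket x y + J (bracket (J x) y) + J (bracket x (J y)) - bracket (J x) (J y) = 0"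
    and snn: "invariant_center bracket J = {0}"
begin

abbreviation Z\<^sub>1 :: "'a set" where
  "Z\<^sub>1 \<equiv> lie_center bracket"

abbreviation Z\<^sub>2 :: "'a set" where
  "Z\<^sub>2 \<equiv> {y. \<forall>u. bracket y u \<in> Z\<^sub>1}"

lemma center_J_zero: "x \<in> Z\<^sub>1 \<Longrightarrow> J x \<in> Z\<^sub>1 \<Longrightarrow> x = 0"
  using snn by (auto simp: invariant_center_def)

lemma center_sum_J_zero:
  assumes "z \<in> Z\<^sub>1" "x \<in> Z\<^sub>1" "z + J x = 0"
  shows "x = 0"
proof -
  have "J x = - z" using assms(3) by (simp add: eq_neg_iff_add_eq_0 add.commute)
  then have "J x \<in> Z\<^sub>1" using assms(1) by (simp add: subspace_neg[OF subspace_center])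
  with assms(2) show ?thesis by (rule center_J_zero)
qed

lemma bracket_J_center:
  assumes "x \<in> Z\<^sub>1"
  shows "bracket (J x) (J y) = J (bracket (J x) y)"
  using nijenhuis[of x y] assms by simp

lemma complex_subspace_centralizer_J_center:
  assumes "x \<in> Z\<^sub>1"
  shows "complex_subspace {u. bracket (J x) u = 0}"
  using assms by (auto simp: complex_subspace_def subspace_def bracket_simps bracket_J_center)

text \<open>The image of \<open>ad (J x)\<close> is stable under \<open>J\<close>, so it vanishes as soon as it lies in a set
  without nonzero pairs \<open>s, J s\<close>; then \<open>x\<close> and \<open>J x\<close> are both central.\<close>

lemma J_center_image_zero:
  assumes "x \<in> Z\<^sub>1" and img: "\<And>u. bracket (J x) u \<in> S"
    and real: "\<And>s. s \<in> S \<Longrightarrow> J s \<in> S \<Longrightarrow> s = 0"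
  shows "x = 0"
proof -
  have "bracket (J x) u = 0" for u
    using real[OF img[of u]] img[of "J u"] bracket_J_center[OF assms(1), of u] by simp
  then have "J x \<in> Z\<^sub>1" by (rule centerI)
  with assms(1) show ?thesis by (rule center_J_zero)
qed

text \<open>Modulo \<open>Z\<^sub>1\<close>, an element of \<open>Z\<^sub>1 + J Z\<^sub>1\<close> is some \<open>J x\<close>; if it belongs to \<open>Z\<^sub>2\<close>, then
  \<open>ad (J x)\<close> has image in \<open>Z\<^sub>1\<close>, and \<open>Z\<^sub>1 \<inter> J Z\<^sub>1 = {0}\<close>.\<close>

lemma second_center_Int_complex_span:
  assumes "y \<in> complex_span Z\<^sub>1" "y \<in> Z\<^sub>2"
  shows "y \<in> Z\<^sub>1"
proof -
  obtain z x where y: "z \<in> Z\<^sub>1" "x \<in> Z\<^sub>1" "y = z + J x"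
    using complex_span_subspaceE[OF subspace_center assms(1)] .
  have "x = 0"
  proof (rule J_center_image_zero[OF y(2)])
    fix u
    have "bracket y u \<in> Z\<^sub>1" using assms(2) by blast
    then show "bracket (J x) u \<in> Z\<^sub>1" using y by (simp add: bracket_simps)
  qed (rule center_J_zero)
  with y show ?thesis by simp
qed

lemma dim_complex_span_center: "dim (complex_span Z\<^sub>1) = 2 * dim Z\<^sub>1"
proof -
  have inj: "inj J"
  proof (rule injI)
    fix x y assume "J x = J y"
    then have "J (J x) = J (J y)" by simp
    then show "x = y" by simp
  qed
  have sub: "subspace (J ` Z\<^sub>1)"
    using subspace_center linear_J by (simp add: linear_subspace_image)
  have "complex_span Z\<^sub>1 = {x + y | x y. x \<in> Z\<^sub>1 \<and> y \<in> J ` Z\<^sub>1}"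
    unfolding complex_span_def span_Un
      span_eq_iff[THEN iffD2, OF subspace_center] span_eq_iff[THEN iffD2, OF sub] by blast
  moreover have "Z\<^sub>1 \<inter> J ` Z\<^sub>1 \<subseteq> {0}"
    using center_J_zero by force
  ultimately show ?thesis
    using dim_direct_sum[OF subspace_center sub] dim_injective_image[OF linear_J inj] by simp
qed

lemma dim_complex_span_insert:
  assumes "v \<notin> complex_span S"
  shows "dim (complex_span (insert v S)) = dim (complex_span S) + 2"
proof -
  let ?T = "S \<union> J ` S"
  have eq: "insert v S \<union> J ` insert v S = insert v (insert (J v) ?T)" by auto
  have *: "a = 0 \<and> b = 0" if "a *\<^sub>R v + b *\<^sub>R J v \<in> span ?T" for a b
    using complex_multiple_notin[OF complex_subspace_span assms] that by (simp add: complex_span_def)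
  have "J v \<notin> span ?T" using *[of 0 1] by auto
  moreover have "v \<notin> span (insert (J v) ?T)"
  proof
    assume "v \<in> span (insert (J v) ?T)"
    then obtain b where "v - b *\<^sub>R J v \<in> span ?T" by (auto simp: span_insert)
    with *[of 1 "- b"] show False by simp
  qed
  ultimately show ?thesis
    unfolding complex_span_def eq dim_span by (simp add: dim_insert_notin)
qed

end

section \<open>Large centers\<close>

text \<open>For \<open>dim UNIV = 2 n\<close> with \<open>n \<ge> 4\<close>, these two assumptions are implied by
  \<open>dim Z\<^sub>1 \<ge> n - 2\<close>. They will be shown to be contradictory.\<close>

locale snn_large_center = snn_lie_algebra +
  assumes dim_center_ge_2: "2 \<le> dim Z\<^sub>1"
    and dim_le: "dim (UNIV :: 'a set) \<le> 2 * dim Z\<^sub>1 + 4"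
begin

text \<open>For \<open>v\<close> in \<open>Z\<^sub>2 - Z\<^sub>1\<close>, this will be an ideal of real codimension at most two.\<close>

definition M :: "'a \<Rightarrow> 'a set" where
  "M v = complex_span (insert v Z\<^sub>1)"

lemma complex_subspace_M: "complex_subspace (M v)"
  by (simp add: M_def complex_subspace_span)

lemma M_minimal: "complex_subspace N \<Longrightarrow> Z\<^sub>1 \<subseteq> N \<Longrightarrow> v \<in> N \<Longrightarrow> M v \<subseteq> N"
  by (simp add: M_def complex_span_minimal)

lemma center_subset_M: "Z\<^sub>1 \<subseteq> M v" and in_M: "v \<in> M v"
  using subset_complex_span[of "insert v Z\<^sub>1"] by (auto simp: M_def)

lemma M_E:
  assumes "y \<in> M v"
  obtains z x a b where "z \<in> Z\<^sub>1" "x \<in> Z\<^sub>1" "y = z + J x + a *\<^sub>R v + b *\<^sub>R J v"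
proof -
  obtain w a b where "w \<in> complex_span Z\<^sub>1" "y = w + a *\<^sub>R v + b *\<^sub>R J v"
    using complex_span_insertE[OF assms[unfolded M_def]] .
  moreover from this obtain z x where "z \<in> Z\<^sub>1" "x \<in> Z\<^sub>1" "w = z + J x"
    using complex_span_subspaceE[OF subspace_center] by blast
  ultimately show thesis using that by blast
qed

lemma not_in_complex_span:
  assumes "v \<in> Z\<^sub>2" "v \<notin> Z\<^sub>1"
  shows "v \<notin> complex_span Z\<^sub>1"
  using assms second_center_Int_complex_span by blast

lemma complex_combination_zero:
  assumes "v \<in> Z\<^sub>2" "v \<notin> Z\<^sub>1" "z \<in> Z\<^sub>1" "x \<in> Z\<^sub>1" "z + J x + a *\<^sub>R v + b *\<^sub>R J v = 0"
  shows "x = 0 \<and> a = 0 \<and> b = 0"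
proof -
  note W = complex_subspaceD[OF complex_subspace_span[of Z\<^sub>1]]
  have "z + J x \<in> complex_span Z\<^sub>1"
    using assms(3,4) subset_complex_span[of Z\<^sub>1] W by (blast intro: subspace_add)
  moreover have "a *\<^sub>R v + b *\<^sub>R J v = - (z + J x)"
    using assms(5) by (simp add: eq_neg_iff_add_eq_0 algebra_simps)
  ultimately have "a *\<^sub>R v + b *\<^sub>R J v \<in> complex_span Z\<^sub>1"
    using W(1) by (metis subspace_neg)
  then have ab: "a = 0 \<and> b = 0"
    by (rule complex_multiple_notin[OF complex_subspace_span not_in_complex_span[OF assms(1,2)]])
  then show ?thesis using assms center_sum_J_zero by simp
qed

text \<open>The space \<open>M v\<close> has real dimension \<open>2 dim Z\<^sub>1 + 2\<close>, so that any \<open>u\<close> outside it completes it to a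
  complex generating set; Engel's argument for the whole algebra supplies one that is bracketed
  into \<open>M v\<close>. If \<open>M v\<close> is already everything, \<open>u = 0\<close> serves, which saves a separate treatment of
  centers of dimension above \<open>n - 2\<close>.\<close>

lemma complement:
  assumes v: "v \<in> Z\<^sub>2" "v \<notin> Z\<^sub>1"
  obtains u where "\<forall>y. bracket u y \<in> M v" "complex_span (insert u (insert v Z\<^sub>1)) = UNIV"
proof (cases "M v = UNIV")
  case True
  have "complex_span (insert v Z\<^sub>1) \<subseteq> complex_span (insert 0 (insert v Z\<^sub>1))"
    using subset_complex_span[of "insert 0 (insert v Z\<^sub>1)"]
    by (intro complex_span_minimal complex_subspace_span) auto
  then have "complex_span (insert 0 (insert v Z\<^sub>1)) = UNIV"
    using True by (auto simp: M_def)
  then show thesis using True by (intro that[of 0]) auto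
next
  case False
  have "0 \<in> M v" using complex_subspaceD(1)[OF complex_subspace_M] by (rule subspace_0)
  with False obtain u where u: "u \<notin> M v" "\<And>y. bracket u y \<in> M v"
    using ideal_element_bracketed_into[OF nilpotent, of UNIV "M v"] by auto
  have "dim (complex_span (insert u (insert v Z\<^sub>1))) = 2 * dim Z\<^sub>1 + 4"
    using u(1) not_in_complex_span[OF v]
    by (simp add: M_def dim_complex_span_insert dim_complex_span_center)
  then have "complex_span (insert u (insert v Z\<^sub>1)) = UNIV"
    using dim_le complex_subspaceD(1)[OF complex_subspace_span] by (intro dim_full_imp_UNIV) auto
  with u(2) that[of u] show thesis by blast
qed

lemma in_complex_subspace_of_generators:
  assumes "complex_span (insert u (insert v Z\<^sub>1)) = UNIV"
    and "complex_subspace N" "Z\<^sub>1 \<subseteq> N" "v \<in> N" "u \<in> N"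
  shows "t \<in> N"
  using complex_span_minimal[of "insert u (insert v Z\<^sub>1)" N] assms by auto

text \<open>For \<open>x\<close> central, the elements that \<open>ad (J x)\<close> maps into \<open>M v\<close> form a complex subspace, and it
  contains the complex generators \<open>Z\<^sub>1\<close>, \<open>v\<close>, \<open>u\<close>. The same holds for \<open>ad (J v)\<close>, which commutes
  with \<open>J\<close> modulo \<open>Z\<^sub>1 + J Z\<^sub>1\<close> because \<open>v \<in> Z\<^sub>2\<close>.\<close>

lemma M_ideal:
  assumes v: "v \<in> Z\<^sub>2" "v \<notin> Z\<^sub>1" and "y \<in> M v"
  shows "bracket y t \<in> M v"
proof -
  obtain u where u: "\<forall>y. bracket u y \<in> M v"
    and gen: "complex_span (insert u (insert v Z\<^sub>1)) = UNIV"
    by (rule complement[OF v])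
  note M = complex_subspaceD[OF complex_subspace_M[of v]]
  have M0: "0 \<in> M v" using M(1) by (rule subspace_0)
  have u': "bracket y u \<in> M v" for y
    using u bracket_antisym[of y u] subspace_neg[OF M(1)] by metis
  have v1: "bracket v t \<in> M v" for t
    using v(1) center_subset_M[of v] by blast
  have v1': "bracket t v \<in> M v" for t
    using v1[of t] bracket_antisym[of t v] subspace_neg[OF M(1)] by metis
  have Jx: "bracket (J x) t \<in> M v" if "x \<in> Z\<^sub>1" for x t
  proof -
    have "t \<in> {t. bracket (J x) t \<in> M v}"
    proof (rule in_complex_subspace_of_generators[OF gen])
      show "complex_subspace {t. bracket (J x) t \<in> M v}"
        using M that unfolding complex_subspace_def subspace_def
        by (simp add: bracket_simps bracket_J_center)
    qed (use u' v1' M0 in auto)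
    then show ?thesis by blast
  qed
  have Jv: "bracket (J v) t \<in> M v" for t
  proof -
    have "t \<in> {t. bracket (J v) t \<in> M v}"
    proof (rule in_complex_subspace_of_generators[OF gen])
      have "bracket (J v) (J t) \<in> M v" if "bracket (J v) t \<in> M v" for t
      proof -
        have "bracket (J v) (J t) = bracket v t + J (bracket (J v) t) + J (bracket v (J t))"
          using nijenhuis[of v t] by simp
        with that show ?thesis using v1 M by (simp add: subspace_add)
      qed
      then show "complex_subspace {t. bracket (J v) t \<in> M v}"
        using M unfolding complex_subspace_def subspace_def by (simp add: bracket_simps)
    qed (use u' v1' M0 in auto)
    then show ?thesis by blast
  qed
  obtain z x a b where "z \<in> Z\<^sub>1" "x \<in> Z\<^sub>1" "y = z + J x + a *\<^sub>R v + b *\<^sub>R J v"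
    using M_E[OF \<open>y \<in> M v\<close>] .
  then show ?thesis
    using Jx Jv v1 M(1) by (simp add: bracket_simps subspace_add subspace_scale)
qed

text \<open>Both \<open>[J x, v]\<close> and its \<open>J\<close>-image \<open>[J x, J v]\<close> are central, hence zero.\<close>

lemma bracket_J_center_M:
  assumes v: "v \<in> Z\<^sub>2" "J v \<in> Z\<^sub>2" and x: "x \<in> Z\<^sub>1" and "y \<in> M v"
  shows "bracket (J x) y = 0"
proof -
  have neg: "bracket (J x) t = - bracket t (J x)" for t by (rule bracket_antisym)
  have "bracket (J x) v \<in> Z\<^sub>1" "bracket (J x) (J v) \<in> Z\<^sub>1"
    using v by (simp_all add: neg subspace_neg[OF subspace_center])
  then have "bracket (J x) v = 0"
    using x by (intro center_J_zero) (simp_all add: bracket_J_center)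
  then have "M v \<subseteq> {t. bracket (J x) t = 0}"
    by (intro M_minimal complex_subspace_centralizer_J_center x) auto
  with \<open>y \<in> M v\<close> show ?thesis by blast
qed

lemma J_center_zero_on_generators:
  assumes "complex_span (insert u (insert v Z\<^sub>1)) = UNIV"
    and "x \<in> Z\<^sub>1" "bracket (J x) v = 0" "bracket (J x) u = 0"
  shows "x = 0"
proof -
  have "t \<in> {t. bracket (J x) t = 0}" for t
    by (rule in_complex_subspace_of_generators[OF assms(1)
        complex_subspace_centralizer_J_center[OF assms(2)]]) (use assms in auto)
  then have "J x \<in> Z\<^sub>1" by (intro centerI) auto
  with assms(2) show ?thesis by (rule center_J_zero)
qed

lemma center_not_in_line:
  obtains x' where "x' \<in> Z\<^sub>1" "\<forall>c. x' \<noteq> c *\<^sub>R x"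
proof -
  have "\<not> Z\<^sub>1 \<subseteq> span {x}"
    using dim_le_card[of "Z\<^sub>1" "{x}"] dim_center_ge_2 by auto
  then show thesis using that by (auto simp: span_singleton)
qed

lemma span_center: "span Z\<^sub>1 = Z\<^sub>1"
  using subspace_center by (simp add: span_eq_iff)

text \<open>Engel's argument for \<open>M v\<close> and \<open>S = Z\<^sub>1 + \<real>v\<close> gives, modulo \<open>S\<close>, an element \<open>J x + b J v\<close> that is
  bracketed into \<open>S\<close>. Here \<open>b \<noteq> 0\<close> by lemma \<open>J_center_image_zero\<close>, since \<open>S \<inter> J S = {0}\<close>. So
  \<open>w = v + x / b\<close> differs from \<open>v\<close> by a central element, and \<open>J w\<close> is bracketed into \<open>S\<close>; the
  Nijenhuis identity for \<open>w\<close> then removes the \<open>v\<close>-component of these brackets.\<close>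

lemma second_center_complex_line:
  obtains v where "v \<notin> Z\<^sub>1" "v \<in> Z\<^sub>2" "J v \<in> Z\<^sub>2"
proof -
  obtain x0 where x0: "x0 \<in> Z\<^sub>1" "x0 \<noteq> 0"
    by (metis center_not_in_line scaleR_zero_right)
  then have "J x0 \<notin> Z\<^sub>1" using center_J_zero by blast
  then have "\<not> UNIV \<subseteq> Z\<^sub>1" by blast
  then obtain v where v: "v \<notin> Z\<^sub>1" "v \<in> Z\<^sub>2"
    using ideal_element_bracketed_into[OF nilpotent, of UNIV "Z\<^sub>1"] subspace_0[OF subspace_center]
    by auto
  note indep = complex_combination_zero[OF v(2,1)]
  note Z = subspace_center
  define S where "S = span (insert v Z\<^sub>1)"
  have S: "subspace S" by (simp add: S_def)
  have ZS: "Z\<^sub>1 \<subseteq> S" and vS: "v \<in> S" by (auto simp: S_def intro: span_base)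
  have SE: "\<exists>z a. z \<in> Z\<^sub>1 \<and> s = z + a *\<^sub>R v" if "s \<in> S" for s
    using that span_insertE[of s v "Z\<^sub>1"] unfolding S_def span_center by blast
  have real: "s = 0" if mem: "s \<in> S" "J s \<in> S" for s
  proof -
    obtain z a where s: "z \<in> Z\<^sub>1" "s = z + a *\<^sub>R v" using SE[OF mem(1)] by blast
    obtain z' a' where s': "z' \<in> Z\<^sub>1" "J s = z' + a' *\<^sub>R v" using SE[OF mem(2)] by blast
    have "- z' + J z + (- a') *\<^sub>R v + a *\<^sub>R J v = 0"
      using s'(2) unfolding s(2) by (simp add: algebra_simps)
    then have "z = 0 \<and> - a' = 0 \<and> a = 0" using s s' Z by (intro indep[of "- z'"]) (auto intro: subspace_neg)
    then show ?thesis using s by simp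
  qed
  have "J x0 \<notin> S"
  proof
    assume "J x0 \<in> S"
    moreover have "- x0 \<in> S" using x0 ZS S by (auto intro: subspace_neg)
    ultimately have "J x0 = 0" using real[of "J x0"] by simp
    with x0 J_J[of x0] show False by simp
  qed
  moreover have "J x0 \<in> M v"
    using x0 center_subset_M[of v] complex_subspaceD(2)[OF complex_subspace_M] by blast
  ultimately obtain y where y: "y \<in> M v" "y \<notin> S" "\<And>u. bracket y u \<in> S"
    using ideal_element_bracketed_into[OF nilpotent, of "M v" S] M_ideal[OF v(2,1)] subspace_0[OF S]
    by blast
  obtain z x a b where zx: "z \<in> Z\<^sub>1" "x \<in> Z\<^sub>1" and y_eq: "y = z + J x + a *\<^sub>R v + b *\<^sub>R J v"
    using M_E[OF y(1)] .
  have vu: "bracket v u \<in> Z\<^sub>1" for u using v by blast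
  have img: "bracket (J x + b *\<^sub>R J v) u \<in> S" for u
  proof -
    have "bracket (J x + b *\<^sub>R J v) u = bracket y u - a *\<^sub>R bracket v u"
      using zx by (simp add: y_eq bracket_simps)
    moreover have "a *\<^sub>R bracket v u \<in> S" using vu ZS S by (blast intro: subspace_scale)
    ultimately show ?thesis using y(3) S by (simp add: subspace_diff)
  qed
  have "b \<noteq> 0"
  proof
    assume b: "b = 0"
    have "x = 0"
      using img real by (intro J_center_image_zero[OF zx(2), of S]) (auto simp: b)
    then have "y \<in> S" using zx ZS vS S by (auto simp: y_eq b intro: subspace_add subspace_scale)
    with y(2) show False by blast
  qed
  define w where "w = v + (1 / b) *\<^sub>R x"
  have wu: "bracket w u = bracket v u" for u using zx by (simp add: w_def bracket_simps)
  have Jwu: "bracket (J w) u \<in> S" for u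
  proof -
    have "J w = (1 / b) *\<^sub>R (J x + b *\<^sub>R J v)" using \<open>b \<noteq> 0\<close> by (simp add: w_def algebra_simps)
    then show ?thesis using img S by (simp add: bracket_simps(7) subspace_scale)
  qed
  have "bracket (J w) u \<in> Z\<^sub>1" for u
  proof -
    obtain z1 r1 where 1: "z1 \<in> Z\<^sub>1" "bracket (J w) u = z1 + r1 *\<^sub>R v" using SE[OF Jwu] by blast
    obtain z2 r2 where 2: "z2 \<in> Z\<^sub>1" "bracket (J w) (J u) = z2 + r2 *\<^sub>R v" using SE[OF Jwu] by blast
    have "(bracket v u - z2) + J (z1 + bracket v (J u)) + (- r2) *\<^sub>R v + r1 *\<^sub>R J v = 0"
      using nijenhuis[of w u] by (simp add: 1 2 wu algebra_simps)
    then have "z1 + bracket v (J u) = 0 \<and> - r2 = 0 \<and> r1 = 0"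
      using 1 2 vu Z by (intro indep[of "bracket v u - z2"]) (auto intro: subspace_diff subspace_add)
    with 1 show ?thesis by simp
  qed
  moreover have "w \<notin> Z\<^sub>1"
  proof
    assume "w \<in> Z\<^sub>1"
    then have "w - (1 / b) *\<^sub>R x \<in> Z\<^sub>1" using zx Z by (blast intro: subspace_diff subspace_scale)
    with v show False by (simp add: w_def)
  qed
  ultimately show thesis using that[of w] vu by (simp add: wu)
qed

text \<open>Starting from \<open>w\<close> with \<open>w, J w \<in> Z\<^sub>2\<close>, Engel's argument for \<open>S = Z\<^sub>1 + \<real>w + \<real>J w\<close> produces a
  central \<open>x \<noteq> 0\<close> with \<open>ad (J x)\<close> of image in \<open>S\<close>, hence in the largest complex subspace
  \<open>\<real>w + \<real>J w\<close> of \<open>S\<close>. Since \<open>ad (J x)\<close> kills \<open>w\<close> but is not zero, it does not kill \<open>u\<close>, and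
  \<open>v = [J x, u]\<close> spans the same complex line as \<open>w\<close>.\<close>

lemma adapted_generators:
  obtains x v u where "x \<in> Z\<^sub>1" "v \<notin> Z\<^sub>1" "v \<in> Z\<^sub>2" "J v \<in> Z\<^sub>2" "bracket (J x) u = v"
    "complex_span (insert u (insert v Z\<^sub>1)) = UNIV"
    "\<forall>x'\<in>Z\<^sub>1. bracket (J x') (bracket u (J u)) = 0"
proof -
  obtain w where w: "w \<notin> Z\<^sub>1" "w \<in> Z\<^sub>2" "J w \<in> Z\<^sub>2" by (rule second_center_complex_line)
  obtain u where u: "\<forall>y. bracket u y \<in> M w"
      and gen: "complex_span (insert u (insert w Z\<^sub>1)) = UNIV"
    by (rule complement[OF w(2,1)])
  note indep = complex_combination_zero[OF w(2,1)]
  note Z = subspace_center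
  define S where "S = span (insert w (insert (J w) Z\<^sub>1))"
  have S: "subspace S" by (simp add: S_def)
  have S_mem: "Z\<^sub>1 \<subseteq> S" "w \<in> S" "J w \<in> S" by (auto simp: S_def intro: span_base)
  have SE: "\<exists>z a b. z \<in> Z\<^sub>1 \<and> s = z + a *\<^sub>R w + b *\<^sub>R J w" if mem: "s \<in> S" for s
  proof -
    obtain s' a where s: "s' \<in> span (insert (J w) Z\<^sub>1)" "s = s' + a *\<^sub>R w"
      using span_insertE[OF mem[unfolded S_def]] .
    obtain z b where z: "z \<in> span Z\<^sub>1" "s' = z + b *\<^sub>R J w"
      using span_insertE[OF s(1)] .
    have "s = z + a *\<^sub>R w + b *\<^sub>R J w" using s z by simp
    with z show ?thesis unfolding span_center by blast
  qed
  obtain x0 where x0: "x0 \<in> Z\<^sub>1" "x0 \<noteq> 0"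
    by (metis center_not_in_line scaleR_zero_right)
  have "J x0 \<notin> S"
  proof
    assume "J x0 \<in> S"
    then obtain z a b where z: "z \<in> Z\<^sub>1" "J x0 = z + a *\<^sub>R w + b *\<^sub>R J w" using SE by blast
    then have "z + J (- x0) + a *\<^sub>R w + b *\<^sub>R J w = 0" by simp
    then have "- x0 = 0 \<and> a = 0 \<and> b = 0" using z x0 Z by (intro indep[of z]) (auto intro: subspace_neg)
    with x0 show False by simp
  qed
  moreover have "J x0 \<in> M w"
    using x0 center_subset_M[of w] complex_subspaceD(2)[OF complex_subspace_M] by blast
  ultimately obtain y where y: "y \<in> M w" "y \<notin> S" "\<And>t. bracket y t \<in> S"
    using ideal_element_bracketed_into[OF nilpotent, of "M w" S] M_ideal[OF w(2,1)] subspace_0[OF S]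
    by blast
  obtain z x a b where zx: "z \<in> Z\<^sub>1" "x \<in> Z\<^sub>1" and y_eq: "y = z + J x + a *\<^sub>R w + b *\<^sub>R J w"
    using M_E[OF y(1)] .
  have img: "bracket (J x) t \<in> S" for t
  proof -
    have "bracket (J x) t = bracket y t - a *\<^sub>R bracket w t - b *\<^sub>R bracket (J w) t"
      using zx by (simp add: y_eq bracket_simps)
    moreover have "bracket w t \<in> S" "bracket (J w) t \<in> S" using w S_mem by auto
    ultimately show ?thesis using y(3) S by (simp add: subspace_diff subspace_scale)
  qed
  have "x \<noteq> 0"
  proof
    assume "x = 0"
    then have "y \<in> S" using zx S S_mem by (auto simp: y_eq intro!: subspace_add subspace_scale)
    with y(2) show False by blast
  qed
  obtain z1 c d where 1: "z1 \<in> Z\<^sub>1" "bracket (J x) u = z1 + c *\<^sub>R w + d *\<^sub>R J w"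
    using SE[OF img] by blast
  obtain z2 c2 d2 where 2: "z2 \<in> Z\<^sub>1" "bracket (J x) (J u) = z2 + c2 *\<^sub>R w + d2 *\<^sub>R J w"
    using SE[OF img] by blast
  \<comment> \<open>Apply \<open>J\<close> to the first expansion and subtract the second.\<close>
  have "- z2 + J z1 + (- d - c2) *\<^sub>R w + (c - d2) *\<^sub>R J w = 0"
    using 2(2) bracket_J_center[OF zx(2), of u] by (simp add: 1 algebra_simps)
  then have "z1 = 0 \<and> - d - c2 = 0 \<and> c - d2 = 0"
    using 1 2 Z by (intro indep[of "- z2"]) (auto intro: subspace_neg)
  then have xu: "bracket (J x) u = c *\<^sub>R w + d *\<^sub>R J w" using 1 by simp
  define v where "v = c *\<^sub>R w + d *\<^sub>R J w"
  have cd: "\<not> (c = 0 \<and> d = 0)"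
  proof
    assume "c = 0 \<and> d = 0"
    moreover have "bracket (J x) w = 0" by (rule bracket_J_center_M[OF w(2,3) zx(2) in_M])
    ultimately have "x = 0" using xu by - (rule J_center_zero_on_generators[OF gen zx(2)], auto)
    with \<open>x \<noteq> 0\<close> show False by blast
  qed
  have "v \<notin> Z\<^sub>1"
  proof
    assume "v \<in> Z\<^sub>1"
    then have "- v \<in> Z\<^sub>1" using Z by (blast intro: subspace_neg)
    moreover have "- v + J 0 + c *\<^sub>R w + d *\<^sub>R J w = 0" by (simp add: v_def)
    ultimately have "0 = (0::'a) \<and> c = 0 \<and> d = 0"
      using Z by (intro indep[of "- v" 0]) (auto intro: subspace_0)
    with cd show False by blast
  qed
  moreover have "v \<in> Z\<^sub>2" "J v \<in> Z\<^sub>2"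
    using w Z by (simp_all add: v_def bracket_simps subspace_add subspace_diff subspace_neg subspace_scale)
  moreover have "complex_span (insert u (insert v Z\<^sub>1)) = UNIV"
  proof -
    let ?N = "complex_span (insert u (insert v Z\<^sub>1))"
    have N: "complex_subspace ?N" "insert u (insert v Z\<^sub>1) \<subseteq> ?N"
      by (simp_all add: complex_subspace_span subset_complex_span)
    have "w \<in> ?N"
      using complex_multiple_notin[OF N(1), of w c d] N(2) cd by (auto simp: v_def)
    then have "t \<in> ?N" for t
      using in_complex_subspace_of_generators[OF gen N(1)] N(2) by blast
    then show ?thesis by blast
  qed
  moreover have "bracket (J x') (bracket u (J u)) = 0" if "x' \<in> Z\<^sub>1" for x'
    by (rule bracket_J_center_M[OF w(2,3) that u[rule_format]])
  ultimately show thesis using that[OF zx(2)] xu v_def by blast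
qed

text \<open>In the notation of the proof, \<open>ad (J x)\<close> maps \<open>u\<close> to \<open>d x\<^sub>1 + c J x\<^sub>1 + \<alpha> v + \<beta> J v\<close>: the image lies in
  the largest complex subspace of \<open>S\<close>. As \<open>[J x, [u, J u]] = 0\<close>, the Jacobi identity for
  \<open>J x, u, J u\<close> reads \<open>c J v - d v + 2 \<beta> q = 0\<close>, where \<open>q = [v, u] \<noteq> 0\<close> is central. So \<open>c\<close>, \<open>d\<close>
  and \<open>\<beta>\<close> vanish, and \<open>J x - \<alpha> J x\<^sub>1\<close> commutes with all generators.\<close>

lemma large_center_impossible: False
proof -
  obtain x1 v u where x1: "x1 \<in> Z\<^sub>1" and v: "v \<notin> Z\<^sub>1" "v \<in> Z\<^sub>2" "J v \<in> Z\<^sub>2"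
    and x1u: "bracket (J x1) u = v"
    and gen: "complex_span (insert u (insert v Z\<^sub>1)) = UNIV"
    and uJu: "\<forall>x'\<in>Z\<^sub>1. bracket (J x') (bracket u (J u)) = 0"
    by (rule adapted_generators)
  note indep = complex_combination_zero[OF v(2,1)]
  note Z = subspace_center
  have vt: "bracket v t \<in> Z\<^sub>1" and Jvt: "bracket (J v) t \<in> Z\<^sub>1" for t using v by auto
  have Jxv: "bracket (J x) v = 0" and JxJv: "bracket (J x) (J v) = 0" if "x \<in> Z\<^sub>1" for x
    using bracket_J_center_M[OF v(2,3) that] in_M[of v] complex_subspaceD(2)[OF complex_subspace_M]
    by blast+
  \<comment> \<open>All brackets of \<open>v\<close> and \<open>J v\<close> are central, so the Nijenhuis identity splits along
    \<open>Z\<^sub>1 + J Z\<^sub>1\<close>.\<close>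
  have nij: "bracket (J v) t + bracket v (J t) = 0 \<and> bracket v t = bracket (J v) (J t)" for t
  proof -
    have "(bracket v t - bracket (J v) (J t)) + J (bracket (J v) t + bracket v (J t)) = 0"
      using nijenhuis[of v t] by (simp add: algebra_simps)
    moreover from this have "bracket (J v) t + bracket v (J t) = 0"
      by (rule center_sum_J_zero[rotated 2]) (use vt Jvt Z in \<open>auto intro: subspace_add subspace_diff\<close>)
    ultimately show ?thesis by simp
  qed
  have x1Ju: "bracket (J x1) (J u) = J v" using bracket_J_center[OF x1] x1u by simp
  have "bracket v (J u) + bracket u (J v) = 0"
    using bracket_bracket[of "J x1" u "J u"] uJu[rule_format, OF x1] by (simp add: x1u x1Ju)
  then have "bracket v (J u) = bracket (J v) u"
    using bracket_antisym[of u "J v"] by simp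
  with nij[of u] have vJu: "bracket v (J u) = 0" and Jvu: "bracket (J v) u = 0"
    by (simp_all add: scaleR_2[symmetric])
  define q where "q = bracket v u"
  have JvJu: "bracket (J v) (J u) = q" using nij[of u] by (simp add: q_def)
  \<comment> \<open>Otherwise \<open>v\<close> and \<open>J v\<close> commute with \<open>u\<close> and with each other, and \<open>v\<close> would be central.\<close>
  have "q \<noteq> 0"
  proof
    assume q: "q = 0"
    have "bracket (J v) v = bracket (bracket (J v) (J x1)) u + bracket (J x1) (bracket (J v) u)"
      using bracket_bracket[of "J v" "J x1" u] by (simp add: x1u)
    also have "\<dots> = 0"
      using JxJv[OF x1] bracket_antisym[of "J v" "J x1"] by (simp add: Jvu bracket_simps)
    finally have Jvv: "bracket (J v) v = 0" .
    have "t \<in> {t. bracket v t = 0 \<and> bracket (J v) t = 0}" for t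
    proof (rule in_complex_subspace_of_generators[OF gen])
      have "bracket v (J t) = 0 \<and> bracket (J v) (J t) = 0"
        if "bracket v t = 0" "bracket (J v) t = 0" for t
        using nij[of t] that by simp
      then show "complex_subspace {t. bracket v t = 0 \<and> bracket (J v) t = 0}"
        by (auto simp: complex_subspace_def subspace_def bracket_simps)
    qed (use Jvv q Jvu in \<open>auto simp: q_def alternating\<close>)
    then have "v \<in> Z\<^sub>1" by (intro centerI) auto
    with v show False by blast
  qed
  define S where "S = span (insert (J x1) (insert v (insert (J v) Z\<^sub>1)))"
  have S: "subspace S" by (simp add: S_def)
  have S_mem: "Z\<^sub>1 \<subseteq> S" "v \<in> S" "J v \<in> S" "J x1 \<in> S" by (auto simp: S_def intro: span_base)
  have SE: "\<exists>z c a b. z \<in> Z\<^sub>1 \<and> s = z + c *\<^sub>R J x1 + a *\<^sub>R v + b *\<^sub>R J v" if mem: "s \<in> S" for s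
  proof -
    obtain s' c where s: "s' \<in> span (insert v (insert (J v) Z\<^sub>1))" "s = s' + c *\<^sub>R J x1"
      using span_insertE[OF mem[unfolded S_def]] .
    obtain s'' a where s'': "s'' \<in> span (insert (J v) Z\<^sub>1)" "s' = s'' + a *\<^sub>R v"
      using span_insertE[OF s(1)] .
    obtain z b where z: "z \<in> span Z\<^sub>1" "s'' = z + b *\<^sub>R J v"
      using span_insertE[OF s''(1)] .
    have "s = z + c *\<^sub>R J x1 + a *\<^sub>R v + b *\<^sub>R J v" using s s'' z by simp
    with z show ?thesis unfolding span_center by blast
  qed
  obtain x0 where x0: "x0 \<in> Z\<^sub>1" "\<forall>c. x0 \<noteq> c *\<^sub>R x1"
    by (rule center_not_in_line[of x1])
  have "J x0 \<notin> S"
  proof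
    assume "J x0 \<in> S"
    then obtain z c a b where z: "z \<in> Z\<^sub>1" "J x0 = z + c *\<^sub>R J x1 + a *\<^sub>R v + b *\<^sub>R J v"
      using SE by blast
    then have "z + J (c *\<^sub>R x1 - x0) + a *\<^sub>R v + b *\<^sub>R J v = 0" by (simp add: algebra_simps)
    then have "c *\<^sub>R x1 - x0 = 0 \<and> a = 0 \<and> b = 0"
      using z x0 x1 Z by (intro indep[of z]) (auto intro: subspace_diff subspace_scale)
    with x0(2) show False by (metis eq_iff_diff_eq_0)
  qed
  moreover have "J x0 \<in> M v"
    using x0 center_subset_M[of v] complex_subspaceD(2)[OF complex_subspace_M] by blast
  ultimately obtain y where y: "y \<in> M v" "y \<notin> S" "\<And>t. bracket y t \<in> S"
    using ideal_element_bracketed_into[OF nilpotent, of "M v" S] M_ideal[OF v(2,1)] subspace_0[OF S]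
    by blast
  obtain z x a b where zx: "z \<in> Z\<^sub>1" "x \<in> Z\<^sub>1" and y_eq: "y = z + J x + a *\<^sub>R v + b *\<^sub>R J v"
    using M_E[OF y(1)] .
  have img: "bracket (J x) t \<in> S" for t
  proof -
    have "bracket (J x) t = bracket y t - a *\<^sub>R bracket v t - b *\<^sub>R bracket (J v) t"
      using zx by (simp add: y_eq bracket_simps)
    moreover have "bracket v t \<in> S" "bracket (J v) t \<in> S" using vt Jvt S_mem by auto
    ultimately show ?thesis using y(3) S by (simp add: subspace_diff subspace_scale)
  qed
  have x_notin: "x \<noteq> r *\<^sub>R x1" for r
  proof
    assume "x = r *\<^sub>R x1"
    then have "y \<in> S" using zx S S_mem by (auto simp: y_eq intro!: subspace_add subspace_scale)
    with y(2) show False by blast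
  qed
  obtain z1 c \<alpha> \<beta> where 1: "z1 \<in> Z\<^sub>1" "bracket (J x) u = z1 + c *\<^sub>R J x1 + \<alpha> *\<^sub>R v + \<beta> *\<^sub>R J v"
    using SE[OF img] by blast
  obtain z2 d \<alpha>2 \<beta>2 where 2: "z2 \<in> Z\<^sub>1"
      "bracket (J x) (J u) = z2 + d *\<^sub>R J x1 + \<alpha>2 *\<^sub>R v + \<beta>2 *\<^sub>R J v"
    using SE[OF img] by blast
  \<comment> \<open>Here too, \<open>J\<close> of the first expansion minus the second; this gives \<open>z1 = d x1\<close>.\<close>
  have "(- z2 - c *\<^sub>R x1) + J (z1 - d *\<^sub>R x1) + (- \<beta> - \<alpha>2) *\<^sub>R v + (\<alpha> - \<beta>2) *\<^sub>R J v = 0"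
    using 2(2) bracket_J_center[OF zx(2), of u] by (simp add: 1 algebra_simps)
  then have "z1 - d *\<^sub>R x1 = 0 \<and> - \<beta> - \<alpha>2 = 0 \<and> \<alpha> - \<beta>2 = 0"
    using 1 2 x1 Z by (intro indep[of "- z2 - c *\<^sub>R x1"]) (auto intro: subspace_neg subspace_diff subspace_scale)
  then have xu: "bracket (J x) u = d *\<^sub>R x1 + c *\<^sub>R J x1 + \<alpha> *\<^sub>R v + \<beta> *\<^sub>R J v" using 1 by simp
  then have xJu: "bracket (J x) (J u) = d *\<^sub>R J x1 - c *\<^sub>R x1 + \<alpha> *\<^sub>R J v - \<beta> *\<^sub>R v"
    using bracket_J_center[OF zx(2), of u] by simp
  have "bracket (bracket (J x) u) (J u) = c *\<^sub>R J v + \<beta> *\<^sub>R q"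
    unfolding xu using x1 by (simp add: bracket_simps x1Ju vJu JvJu)
  moreover have "bracket (bracket (J x) (J u)) u = d *\<^sub>R v - \<beta> *\<^sub>R q"
    unfolding xJu using x1 by (simp add: bracket_simps x1u Jvu q_def)
  ultimately have "(c *\<^sub>R J v + \<beta> *\<^sub>R q) + (\<beta> *\<^sub>R q - d *\<^sub>R v) = 0"
    using bracket_bracket[of "J x" u "J u"] uJu[rule_format, OF zx(2)]
      bracket_antisym[of u "bracket (J x) (J u)"]
    by simp
  then have comb: "(\<beta> *\<^sub>R q + \<beta> *\<^sub>R q) + J 0 + (- d) *\<^sub>R v + c *\<^sub>R J v = 0"
    by (simp add: algebra_simps)
  then have "0 = (0::'a) \<and> - d = 0 \<and> c = 0"
    using vt Z by (intro indep[of "\<beta> *\<^sub>R q + \<beta> *\<^sub>R q" 0])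
      (auto simp: q_def intro: subspace_add subspace_scale subspace_0)
  then have "d = 0" "c = 0" by auto
  moreover from this comb have "\<beta> *\<^sub>R q + \<beta> *\<^sub>R q = 0" by simp
  then have "(\<beta> + \<beta>) *\<^sub>R q = 0" by (simp only: scaleR_left_distrib)
  then have "\<beta> = 0" using \<open>q \<noteq> 0\<close> by simp
  ultimately have "bracket (J (x - \<alpha> *\<^sub>R x1)) u = 0" by (simp add: bracket_simps xu x1u)
  moreover have "x - \<alpha> *\<^sub>R x1 \<in> Z\<^sub>1" using zx x1 Z by (auto intro: subspace_diff subspace_scale)
  ultimately have "x - \<alpha> *\<^sub>R x1 = 0"
    using J_center_zero_on_generators[OF gen] Jxv by blast
  with x_notin[of \<alpha>] show False by simp
qed

end

theorem theorem3p11: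
  fixes bracket :: "'a::real_vector \<Rightarrow> 'a \<Rightarrow> 'a"
    and J :: "'a \<Rightarrow> 'a"
    and n :: nat
  assumes "n \<ge> 4"
    and "real_lie_algebra bracket"
    and "dim (UNIV :: 'a set) = 2 * n"
    and "lie_nilpotent bracket"
    and "complex_structure bracket J"
    and "strongly_non_nilpotent bracket J"
  shows "1 \<le> dim (lie_center bracket) \<and> dim (lie_center bracket) \<le> n - 3"
proof
  interpret real_lie_algebra bracket by fact
  note J = assms(5)[unfolded complex_structure_def]
  interpret complex_operator J
    by (rule complex_operator.intro) (use J in blast)+
  interpret snn_lie_algebra bracket J
  proof
    show "bracket x y + J (bracket (J x) y) + J (bracket x (J y)) - bracket (J x) (J y) = 0" for x y
      using J by blast
  qed (use assms(4,6) strongly_non_nilpotent_def in blast)+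
  have "\<not> (UNIV :: 'a set) \<subseteq> {0}"
    using dim_le_card[of "UNIV :: 'a set" "{}"] assms(1,3) by auto
  then obtain y where "y \<noteq> 0" "\<And>u. bracket y u = 0"
    using ideal_element_bracketed_into[OF nilpotent, of UNIV "{0}"] by auto
  then show "1 \<le> dim (lie_center bracket)"
    by (intro dim_pos[of y]) (auto intro: centerI)
  show "dim (lie_center bracket) \<le> n - 3"
  proof (rule ccontr)
    assume "\<not> ?thesis"
    then interpret snn_large_center bracket J
      using assms(1,3) by unfold_locales auto
    show False by (rule large_center_impossible)
  qed
qed

end
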